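(* For each non-negative integer $N$, $$r(1,1,2;N)=\begin{cases}r(2,4,4;N)+4\,rT(2,8,8;N-2)&\text{if }N\equiv0\pmod2,\\4\,T(2,2,4;N-1)&\text{if }N\equiv1\pmod2.\end{cases}$$
   Context: $\mathbb{N}_0=\{0,1,2,\dots\}$ and $t_n=n(n+1)/2$ (triangular numbers). For positive integers $a_1,a_2,a_3$ and an integer $N$: $r(a_1,a_2,a_3;N)=|\{(l,m,n)\in\mathbb{Z}^3: N=a_1l^2+a_2m^2+a_3n^2\}|$; $rT(a_1,a_2,a_3;N)=|\{(l,m,n)\in\mathbb{Z}\times\mathbb{N}_0^2: N=a_1l^2+a_2t_m+a_3t_n\}|$; $T(a_1,a_2,a_3;N)=|\{(l,m,n)\in\mathbb{N}_0^3: N=a_1t_l+a_2t_m+a_3t_n\}|$. In particular these counts are $0$ when $N<0$. *)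

theory Defs
  imports Main
begin

definition tri :: "nat \<Rightarrow> nat" where
  "tri n = n * (n + 1) div 2"

(* The counts below are meant for positive coefficients, where the solution sets are finite;
   card is 0 on infinite sets. The target N ranges over int so that shifted arguments such as
   N - 2 may be negative (count 0) rather than being truncated. *)

definition r_count :: "nat \<Rightarrow> nat \<Rightarrow> nat \<Rightarrow> int \<Rightarrow> nat" where
  "r_count a1 a2 a3 N = card {(l :: int, m :: int, n :: int).
     N = int a1 * l\<^sup>2 + int a2 * m\<^sup>2 + int a3 * n\<^sup>2}"

definition rT_count :: "nat \<Rightarrow> nat \<Rightarrow> nat \<Rightarrow> int \<Rightarrow> nat" where
  "rT_count a1 a2 a3 N = card {(l :: int, m :: nat, n :: nat).
     N = int a1 * l\<^sup>2 + int a2 * int (tri m) + int a3 * int (tri n)}"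

definition T_count :: "nat \<Rightarrow> nat \<Rightarrow> nat \<Rightarrow> int \<Rightarrow> nat" where
  "T_count a1 a2 a3 N = card {(l :: nat, m :: nat, n :: nat).
     N = int a1 * int (tri l) + int a2 * int (tri m) + int a3 * int (tri n)}"

end

theory Submission
  imports Defs
begin

text \<open>
  In a solution of \<open>l\<^sup>2 + m\<^sup>2 + 2n\<^sup>2 = N\<close> with \<open>N\<close> even, \<open>l\<close> and \<open>m\<close> have the same parity: the even
  pairs give \<open>r(2,4,4;N)\<close>, and the odd pairs, split by their two signs, give \<open>4 rT(2,8,8;N-2)\<close> because
  \<open>8 t\<^sub>a + 1 = (2a+1)\<^sup>2\<close>.

  For odd \<open>N\<close> put \<open>p = l + m + 2n\<close>, \<open>q = l + m - 2n\<close>, \<open>r = l - m\<close>. Then \<open>p, q, r\<close> are odd with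
  \<open>p\<^sup>2 + q\<^sup>2 + 2r\<^sup>2 = 4N\<close> and \<open>p \<equiv> q\<close> modulo 4, and every such triple arises once. The signs of
  \<open>p\<close> and \<open>r\<close> are free while the congruence determines the sign of \<open>q\<close>, so each triple of absolute
  values, that is each solution counted by \<open>T(2,2,4;N-1)\<close>, arises four times.
\<close>

lemma int_tri: "2 * int (tri a) = int a * (int a + 1)"
proof -
  have "2 * tri a = a * (a + 1)"
    unfolding tri_def by simp
  then have "int (2 * tri a) = int (a * (a + 1))" by simp
  then show ?thesis by (simp add: distrib_left)
qed

text \<open>Separating the sign from the index makes each choice of sign a factor of 2 in the
  counts, while the index is the argument of the triangular number.\<close>

definition signed_odd :: "bool \<Rightarrow> nat \<Rightarrow> int" where
  "signed_odd s a = (if s then 2 * int a + 1 else - (2 * int a + 1))"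

lemma odd_signed_odd [simp]: "odd (signed_odd s a)"
  by (simp add: signed_odd_def)

lemma signed_odd_eq_iff [simp]: "signed_odd s a = signed_odd t b \<longleftrightarrow> s = t \<and> a = b"
  unfolding signed_odd_def by (cases s; cases t) presburger+

lemma signed_odd_square: "(signed_odd s a)\<^sup>2 = 8 * int (tri a) + 1"
  using int_tri[of a] by (simp add: signed_odd_def power2_eq_square algebra_simps)

lemma odd_imp_signed_odd:
  assumes "odd v"
  obtains s a where "v = signed_odd s a"
proof (cases "v > 0")
  case True
  with assms have "v = signed_odd True (nat (v div 2))"
    unfolding signed_odd_def by simp
  then show ?thesis by (rule that)
next
  case False
  with assms have "v = signed_odd False (nat ((- v) div 2))"
    unfolding signed_odd_def by simp
  then show ?thesis by (rule that)
qed

text \<open>The two candidates \<open>2 * a + 1\<close> and its negative differ by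
  \<open>4 * a + 2\<close>, which is 2 modulo 4, so they represent both odd residue classes, and
  \<open>p\<close> lies in exactly one.\<close>

lemma odd_cong_mod4_unique_sign:
  fixes p :: int
  assumes "odd p"
  shows "\<exists>!s. 4 dvd p - signed_odd s a"
proof -
  have "4 dvd p - (2 * int a + 1) \<longleftrightarrow> \<not> 4 dvd p - - (2 * int a + 1)"
    using assms by presburger
  then show ?thesis
    unfolding signed_odd_def Ex1_def by (auto simp: all_bool_eq ex_bool_eq)
qed

text \<open>Each term is nonnegative, so it is at most \<open>N\<close>, and an integer is bounded
  by its square. Finiteness is what allows the cardinalities of the even and odd parts to be
  added.\<close>

lemma finite_ternary_solutions:
  fixes N :: int
  assumes "a > 0" "b > 0" "c > 0"
  shows "finite {(l :: int, m :: int, n :: int).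
    N = int a * l\<^sup>2 + int b * m\<^sup>2 + int c * n\<^sup>2}" (is "finite ?S")
proof (rule finite_subset)
  have bound: "\<bar>x\<bar> \<le> N" if "int k * x\<^sup>2 \<le> N" "k > 0" for x k
  proof -
    have "\<bar>x\<bar> \<le> x\<^sup>2"
      using self_le_power[of "\<bar>x\<bar>" 2] by (cases "x = 0") auto
    also have "\<dots> \<le> int k * x\<^sup>2"
      using that(2) mult_right_mono[of 1 "int k" "x\<^sup>2"] by simp
    finally show ?thesis using that(1) by simp
  qed
  show "?S \<subseteq> {-N..N} \<times> {-N..N} \<times> {-N..N}"
  proof
    fix x assume "x \<in> ?S"
    then obtain l m n where x: "x = (l, m, n)"
      and N: "N = int a * l\<^sup>2 + int b * m\<^sup>2 + int c * n\<^sup>2" by auto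
    have "0 \<le> int a * l\<^sup>2" "0 \<le> int b * m\<^sup>2" "0 \<le> int c * n\<^sup>2" by simp_all
    with N have "int a * l\<^sup>2 \<le> N" "int b * m\<^sup>2 \<le> N" "int c * n\<^sup>2 \<le> N" by linarith+
    with assms have "\<bar>l\<bar> \<le> N" "\<bar>m\<bar> \<le> N" "\<bar>n\<bar> \<le> N" by (blast intro: bound)+
    then show "x \<in> {-N..N} \<times> {-N..N} \<times> {-N..N}" unfolding x by auto
  qed
qed simp

lemma card_signs_times: "card ((UNIV :: (bool \<times> bool) set) \<times> S) = 4 * card S"
proof -
  have "card (UNIV :: (bool \<times> bool) set) = 4"
    by (subst UNIV_Times_UNIV[symmetric]) (simp only: card_cartesian_product, simp)
  then show ?thesis by (simp add: card_cartesian_product)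
qed

lemma card_even_part:
  "card {(l :: int, m :: int, n :: int). even l \<and> even m \<and> N = l\<^sup>2 + m\<^sup>2 + 2 * n\<^sup>2} =
     r_count 2 4 4 N"
proof -
  \<comment> \<open>The coordinates are permuted because the coefficient 2 belongs to the variable
    that is not doubled.\<close>
  have "bij_betw (\<lambda>(l, m, n). (2 * m, 2 * n, l))
      {(l :: int, m :: int, n :: int). N = int 2 * l\<^sup>2 + int 4 * m\<^sup>2 + int 4 * n\<^sup>2}
      {(l, m, n). even l \<and> even m \<and> N = l\<^sup>2 + m\<^sup>2 + 2 * n\<^sup>2}"
    by (rule bij_betw_byWitness[where f' = "\<lambda>(l, m, n). (n, l div 2, m div 2)"])
      (auto elim!: evenE simp: power_mult_distrib)
  then show ?thesis
    unfolding r_count_def by (rule bij_betw_same_card[symmetric])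
qed

lemma card_odd_part:
  "card {(l :: int, m :: int, n :: int). odd l \<and> odd m \<and> N = l\<^sup>2 + m\<^sup>2 + 2 * n\<^sup>2} =
     4 * rT_count 2 8 8 (N - 2)" (is "card ?O = _")
proof -
  let ?R = "{(l :: int, a :: nat, b :: nat).
     N - 2 = int 2 * l\<^sup>2 + int 8 * int (tri a) + int 8 * int (tri b)}"
  let ?f = "\<lambda>((s, t), l, a, b). (signed_odd s a, signed_odd t b, l)"
  have "?O \<subseteq> ?f ` (UNIV \<times> ?R)"
  proof
    fix x assume "x \<in> ?O"
    then obtain l m n where x: "x = (l, m, n)" and "odd l" "odd m"
      and N: "N = l\<^sup>2 + m\<^sup>2 + 2 * n\<^sup>2" by auto
    then obtain s a t b where lm: "l = signed_odd s a" "m = signed_odd t b"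
      by (meson odd_imp_signed_odd)
    \<comment> \<open>Each of the two odd squares is 1 more than 8 times a triangular number, whence
      the shift from \<open>N\<close> to \<open>N - 2\<close>.\<close>
    have "(n, a, b) \<in> ?R"
      unfolding mem_Collect_eq prod.case N lm signed_odd_square by simp
    then show "x \<in> ?f ` (UNIV \<times> ?R)"
      by (intro image_eqI[where x = "((s, t), n, a, b)"]) (auto simp: x lm)
  qed
  moreover have "?f ` (UNIV \<times> ?R) \<subseteq> ?O"
    by (auto simp: signed_odd_square)
  moreover have "inj_on ?f (UNIV \<times> ?R)"
    by (auto simp: inj_on_def)
  ultimately have "bij_betw ?f (UNIV \<times> ?R) ?O"
    unfolding bij_betw_def by blast
  then show ?thesis
    unfolding rT_count_def card_signs_times[symmetric] by (rule bij_betw_same_card[symmetric])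
qed

lemma r_count_even:
  assumes "even N"
  shows "r_count 1 1 2 N = r_count 2 4 4 N + 4 * rT_count 2 8 8 (N - 2)"
proof -
  let ?S = "{(l :: int, m :: int, n :: int). N = int 1 * l\<^sup>2 + int 1 * m\<^sup>2 + int 2 * n\<^sup>2}"
  let ?E = "{(l :: int, m :: int, n :: int). even l \<and> even m \<and> N = l\<^sup>2 + m\<^sup>2 + 2 * n\<^sup>2}"
  let ?O = "{(l :: int, m :: int, n :: int). odd l \<and> odd m \<and> N = l\<^sup>2 + m\<^sup>2 + 2 * n\<^sup>2}"
  have "even l \<longleftrightarrow> even m" if "N = l\<^sup>2 + m\<^sup>2 + 2 * n\<^sup>2" for l m n :: int
    using assms that by simp
  then have split: "?S = ?E \<union> ?O" by auto
  have "finite ?S" by (rule finite_ternary_solutions) simp_all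
  with split have "card ?S = card ?E + card ?O"
    by (subst split, intro card_Un_disjoint) auto
  then show ?thesis
    unfolding r_count_def[of 1 1 2] card_even_part card_odd_part .
qed

lemma r_count_odd:
  assumes "odd N"
  shows "r_count 1 1 2 N = 4 * T_count 2 2 4 (N - 1)"
proof -
  let ?S = "{(l :: int, m :: int, n :: int). N = int 1 * l\<^sup>2 + int 1 * m\<^sup>2 + int 2 * n\<^sup>2}"
  let ?T = "{(a :: nat, b :: nat, c :: nat).
     N - 1 = int 2 * int (tri a) + int 2 * int (tri b) + int 4 * int (tri c)}"
  define P where "P = {(p :: int, q :: int, r :: int).
     odd p \<and> odd q \<and> odd r \<and> 4 dvd p - q \<and> 4 * N = p\<^sup>2 + q\<^sup>2 + 2 * r\<^sup>2}"
  \<comment> \<open>The description is meaningful only for odd \<open>p\<close>; for even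
    \<open>p\<close> no sign satisfies the congruence.\<close>
  define sgn_q where "sgn_q p b = (THE s. 4 dvd p - signed_odd s b)" for p b
  have sgn_q: "4 dvd p - signed_odd s b \<longleftrightarrow> s = sgn_q p b" if "odd p" for p s b
    using theI'[OF odd_cong_mod4_unique_sign[OF that, of b]]
      odd_cong_mod4_unique_sign[OF that, of b]
    unfolding sgn_q_def by blast
  let ?g = "\<lambda>((s, t), a, b, c). let p = signed_odd s a in
     (p, signed_odd (sgn_q p b) b, signed_odd t c)"
  have "bij_betw (\<lambda>(l, m, n). (l + m + 2 * n, l + m - 2 * n, l - m)) ?S P"
  \<comment> \<open>The inverse comes from \<open>p + q = 2 * (l + m)\<close> and
    \<open>p - q = 4 * n\<close>: half of \<open>p + q\<close>, plus or minus \<open>r\<close>, is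
    \<open>2 * l\<close> or \<open>2 * m\<close>.\<close>
  proof (rule bij_betw_byWitness[where
      f' = "\<lambda>(p, q, r). (((p + q) div 2 + r) div 2, ((p + q) div 2 - r) div 2, (p - q) div 4)"])
    show "(\<lambda>(l, m, n). (l + m + 2 * n, l + m - 2 * n, l - m)) ` ?S \<subseteq> P"
    proof clarify
      fix l m n :: int
      assume N: "N = int 1 * l\<^sup>2 + int 1 * m\<^sup>2 + int 2 * n\<^sup>2"
      with assms have "odd (l + m)" by simp
      then have "odd (l + m + 2 * n)" "odd (l + m - 2 * n)" "odd (l - m)" by simp_all
      moreover have "4 dvd (l + m + 2 * n) - (l + m - 2 * n)" by simp
      moreover have "4 * N = (l + m + 2 * n)\<^sup>2 + (l + m - 2 * n)\<^sup>2 + 2 * (l - m)\<^sup>2"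
        unfolding N by (simp add: power2_eq_square algebra_simps)
      ultimately show "(l + m + 2 * n, l + m - 2 * n, l - m) \<in> P"
        unfolding P_def by blast
    qed
  next
    \<comment> \<open>Every triple in \<open>P\<close> is of the form produced by the forward map,
      so the divisions in the inverse are exact and cancel after substitution.\<close>
    have P_cases: "\<exists>l m n. p = l + m + 2 * n \<and> q = l + m - 2 * n \<and> r = l - m"
      if "(p, q, r) \<in> P" for p q r
    proof -
      from that have odds: "odd p" "odd q" "odd r" and "4 dvd p - q"
        unfolding P_def by auto
      then obtain n where n: "p - q = 4 * n" by blast
      \<comment> \<open>With \<open>q + 2 * n\<close> in the role of \<open>l + m\<close> and
        \<open>r\<close> in that of \<open>l - m\<close>, this sum has to be \<open>2 * l\<close>;
        then \<open>m\<close> is \<open>l - r\<close>.\<close>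
      have "even (q + 2 * n + r)" using odds by simp
      then obtain l where "q + 2 * n + r = 2 * l" by blast
      with n have "p = l + (l - r) + 2 * n \<and> q = l + (l - r) - 2 * n \<and> r = l - (l - r)"
        by linarith
      then show ?thesis by blast
    qed
    show "\<forall>x\<in>P. (\<lambda>(l, m, n). (l + m + 2 * n, l + m - 2 * n, l - m))
       ((\<lambda>(p, q, r). (((p + q) div 2 + r) div 2, ((p + q) div 2 - r) div 2, (p - q) div 4)) x) = x"
      by (auto dest!: P_cases)
    show "(\<lambda>(p, q, r). (((p + q) div 2 + r) div 2, ((p + q) div 2 - r) div 2, (p - q) div 4)) ` P
       \<subseteq> ?S"
    proof clarify
      fix p q r
      assume "(p, q, r) \<in> P"
      with P_cases obtain l m n where eqs: "p = l + m + 2 * n" "q = l + m - 2 * n" "r = l - m"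
        by blast
      from \<open>(p, q, r) \<in> P\<close> have "4 * N = p\<^sup>2 + q\<^sup>2 + 2 * r\<^sup>2"
        unfolding P_def by simp
      then have "N = l\<^sup>2 + m\<^sup>2 + 2 * n\<^sup>2"
        unfolding eqs by (simp add: power2_eq_square algebra_simps)
      then show "N = int 1 * (((p + q) div 2 + r) div 2)\<^sup>2
          + int 1 * (((p + q) div 2 - r) div 2)\<^sup>2 + int 2 * ((p - q) div 4)\<^sup>2"
        unfolding eqs by simp
    qed
  qed auto
  then have "card ?S = card P" by (rule bij_betw_same_card)
  have "bij_betw ?g (UNIV \<times> ?T) P"
    unfolding bij_betw_def
  proof
    \<comment> \<open>The first component already fixes \<open>s\<close> and \<open>a\<close>, so
      the computed sign of the second loses no information.\<close>
    show "inj_on ?g (UNIV \<times> ?T)"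
      by (auto simp: inj_on_def Let_def)
    show "?g ` (UNIV \<times> ?T) = P"
    proof
      show "?g ` (UNIV \<times> ?T) \<subseteq> P"
        by (auto simp: P_def Let_def sgn_q signed_odd_square)
      show "P \<subseteq> ?g ` (UNIV \<times> ?T)"
      proof clarify
        fix p q r
        assume "(p, q, r) \<in> P"
        then have odds: "odd p" "odd q" "odd r" and pq: "4 dvd p - q"
          and N: "4 * N = p\<^sup>2 + q\<^sup>2 + 2 * r\<^sup>2"
          unfolding P_def by auto
        from odds obtain s a u b t c
          where eqs: "p = signed_odd s a" "q = signed_odd u b" "r = signed_odd t c"
          by (meson odd_imp_signed_odd)
        have "u = sgn_q p b"
          using pq sgn_q[OF \<open>odd p\<close>] unfolding eqs(2) by simp
        \<comment> \<open>The squares turn the equation into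
          \<open>4 * N = 8 * tri a + 8 * tri b + 16 * tri c + 4\<close>; division by 4 gives the
          target \<open>N - 1\<close>.\<close>
        moreover have "(a, b, c) \<in> ?T"
          using N unfolding eqs signed_odd_square by simp
        ultimately show "(p, q, r) \<in> ?g ` (UNIV \<times> ?T)"
          by (intro image_eqI[where x = "((s, t), a, b, c)"]) (auto simp: eqs Let_def)
      qed
    qed
  qed
  then have "4 * card ?T = card P"
    unfolding card_signs_times[symmetric] by (rule bij_betw_same_card)
  with \<open>card ?S = card P\<close> show ?thesis
    unfolding r_count_def T_count_def by simp
qed

theorem theorem5p6:
  fixes N :: int
  assumes "N \<ge> 0"
  shows "r_count 1 1 2 N =
    (if N mod 2 = 0 then r_count 2 4 4 N + 4 * rT_count 2 8 8 (N - 2)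
     else 4 * T_count 2 2 4 (N - 1))"
  using r_count_even[of N] r_count_odd[of N] by presburger

end
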